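(* Let $Z$ be a Hausdorff topological vector space and let $X$ be a nonempty compact convex subset of a topological vector space $E$. Let $C\subset Z$ be a pointed closed convex cone with nonempty interior and let $K:X\rightrightarrows X$ and $f:X\times X\rightrightarrows Z$ be correspondences with nonempty values. Let $A=\{x\in X:\text{ there exists }u\in K(x)\text{ such that }f(x,u)\cap\operatorname{int}C=\emptyset\}$. Assume that: (i) $K$ is open (respectively closed) valued and for each $x\in X$, the set $\{u\in X: f(x,u)\cap\operatorname{int}C=\emptyset\}$ is open (respectively closed); (ii) $f(x,x)\cap\operatorname{int}C\neq\emptyset$ for each $x\in X$; (iii) there exists $M\in\langle X\rangle$ such that $$\bigcup_{x\in M\cap A}\bigl[\{u\in X: f(x,u)\cap\operatorname{int}C=\emptyset\}\cap K(x)\bigr]\ \cup\ \bigcup_{x\in M\setminus A}K(x)=X;$$ (iv) $K^{-1}:X\rightrightarrows X$ is convex valued and for each $u\in X$, the set $\{x\in X: f(x,u)\cap\operatorname{int}C=\emptyset\}\cup(X\setminus A)$ is convex. Then there exists $x^{*}\in X$ such that $x^{*}\in K(x^{*})$ and $f(x^{*},y)\cap\operatorname{int}C\neq\emptyset$ for each $y\in K(x^{*})$.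
   Context: A correspondence $T:X\rightrightarrows Y$ is a set-valued map assigning to each $x\in X$ a subset $T(x)\subseteq Y$. $K^{-1}(u)=\{x\in X: u\in K(x)\}$. $\langle X\rangle$ denotes the class of all nonempty finite subsets of $X$. Openness and closedness of subsets of $X$ are in the subspace topology of $X$; $\operatorname{int}C$ is the interior of $C$ in $Z$. The result consists of two versions: one with "open" in both places of (i), one with "closed" in both places of (i). *)

theory Defs
  imports "HOL-Analysis.Analysis"
begin

text \<open>
  Real topological vector spaces; neither local convexity nor any separation axiom is included,
  so the Hausdorff property is required separately through the class \<open>t2_space\<close>.
  The condition on \<open>scaleR\<close> is joint continuity, in the style of \<open>tendsto_add_Pair\<close>.
\<close>

class topological_real_vector = topological_ab_group_add + real_vector +
  assumes tendsto_scaleR_Pair: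
    "LIM p (nhds c \<times>\<^sub>F nhds x). fst p *\<^sub>R snd p :> nhds (c *\<^sub>R x)"

instance real_normed_vector \<subseteq> topological_real_vector
proof
  fix c :: real and x :: 'a
  show "LIM p (nhds c \<times>\<^sub>F nhds x). fst p *\<^sub>R snd p :> nhds (c *\<^sub>R x)"
    unfolding nhds_prod[symmetric]
    by (intro tendsto_scaleR tendsto_fst tendsto_snd filterlim_ident)
      (simp_all add: nhds_prod filterlim_fst filterlim_snd)
qed

text \<open>
  A correspondence from \<open>X\<close> to \<open>Y\<close> is a set-valued function whose values at points of \<open>X\<close> are
  subsets of \<open>Y\<close>; its values outside \<open>X\<close> are irrelevant.
\<close>

definition correspondence :: "'a set \<Rightarrow> 'b set \<Rightarrow> ('a \<Rightarrow> 'b set) \<Rightarrow> bool" where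
  "correspondence X Y T \<longleftrightarrow> (\<forall>x\<in>X. T x \<subseteq> Y)"

definition lower_inverse :: "'a set \<Rightarrow> ('a \<Rightarrow> 'b set) \<Rightarrow> 'b \<Rightarrow> 'a set" where
  "lower_inverse X T u = {x \<in> X. u \<in> T x}"

text \<open>The library predicate \<open>cone\<close> does not include pointedness.\<close>

definition pointed_cone :: "'a::real_vector set \<Rightarrow> bool" where
  "pointed_cone C \<longleftrightarrow> cone C \<and> C \<inter> uminus ` C = {0}"

end

theory Submission
  imports Defs
begin

text \<open>
  Write \<open>P x = {u \<in> X. f (x, u) \<inter> interior C = {}}\<close> and set \<open>G x = P x \<inter> K x\<close> for
  \<open>x \<in> A\<close> and \<open>G x = K x\<close> for \<open>x \<in> X - A\<close>. Hypothesis (i) makes all the sets \<open>G x\<close>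
  relatively open, or all of them relatively closed, and (iii) says that finitely many of them,
  those with \<open>x \<in> M\<close>, cover the convex set \<open>X\<close>. Ky Fan's matching theorem (\<open>fan_matching\<close>)
  then yields a point \<open>u \<in> X\<close> in the convex hull of \<open>{x \<in> M. u \<in> G x}\<close>. For fixed \<open>u\<close> the
  fibre \<open>{x \<in> X. u \<in> G x}\<close> is the intersection of the two convex sets of (iv), so it contains
  \<open>u\<close>; that is, \<open>u \<in> G u\<close>. By (ii), \<open>u \<notin> P u\<close>, hence \<open>u \<notin> A\<close> and \<open>u \<in> K u\<close>, which is
  the claim by definition of \<open>A\<close>.

  The map sending barycentric coordinates to a convex combination of the points of \<open>M\<close> is
  continuous even when \<open>E\<close> is not Hausdorff, so the matching theorem reduces to one about
  covers of a standard simplex: some point \<open>x\<close> lies in the \<open>i\<close>-th set whenever \<open>x i > 0\<close>.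
  When the \<open>i\<close>-th set is \<open>{x. \<beta> i x > 0}\<close> with \<open>\<beta> i\<close> continuous and nonnegative, a Brouwer fixed
  point of \<open>\<beta>\<close>, normalised to take values in the simplex, has this property (\<open>prob_simplex_point_in_cozero_sets\<close>).
  Distance functions turn open sets into such sets, and closed covers follow by applying the
  result to shrinking neighbourhoods and passing to the limit.

  The size of \<open>M\<close> is a variable, whereas the dimension of a Euclidean space is part of its type.
  Brouwer's theorem is therefore proved, from Kuhn's combinatorial lemma, for cubes of
  variable dimension inside the space of real sequences.
\<close>

section \<open>Brouwer's theorem for a cube of variable dimension\<close>

text \<open>
  The \<open>n\<close>-dimensional cube, its points being extended by \<open>0\<close> to real sequences, so that it is
  a compact subset of the metrizable product space \<open>nat \<Rightarrow> real\<close>.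
\<close>

definition unit_cube :: "nat \<Rightarrow> (nat \<Rightarrow> real) set" where
  "unit_cube n = {x. (\<forall>i<n. 0 \<le> x i \<and> x i \<le> 1) \<and> (\<forall>i\<ge>n. x i = 0)}"

lemma tendsto_coordinatewise:
  fixes f :: "'b \<Rightarrow> 'i \<Rightarrow> 'a::topological_space"
  assumes "\<And>i. ((\<lambda>m. f m i) \<longlongrightarrow> l i) \<F>"
  shows "(f \<longlongrightarrow> l) \<F>"
proof -
  have "limitin (product_topology (\<lambda>i. euclidean) UNIV) f l \<F>"
    unfolding limitin_componentwise using assms by simp
  then show ?thesis
    by (simp add: euclidean_product_topology)
qed

lemma tendsto_coordinate:
  fixes f :: "'b \<Rightarrow> 'i \<Rightarrow> 'a::topological_space"
  assumes "(f \<longlongrightarrow> l) \<F>"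
  shows "((\<lambda>m. f m i) \<longlongrightarrow> l i) \<F>"
proof -
  have "limitin (product_topology (\<lambda>i. euclidean) UNIV) f l \<F>"
    using assms by (simp add: euclidean_product_topology)
  then show ?thesis
    by (simp add: limitin_componentwise)
qed

lemma compact_unit_cube: "compact (unit_cube n)"
proof -
  have "x \<in> unit_cube n \<longleftrightarrow> (\<forall>i. x i \<in> (if i < n then {0..1} else {0}))" for x
    by (simp add: unit_cube_def all_conj_distrib flip: not_less)
  then have "unit_cube n = PiE UNIV (\<lambda>i. if i < n then {0..1} else {0})"
    by (simp only: set_eq_iff PiE_iff extensional_UNIV UNIV_I ball_UNIV simp_thms)
  moreover have "compactin (product_topology (\<lambda>i::nat. euclideanreal) UNIV)
      (PiE UNIV (\<lambda>i. if i < n then {0..1} else {0}))"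
    unfolding compactin_PiE by auto
  ultimately show ?thesis
    by (simp add: euclidean_product_topology)
qed

text \<open>
  An approximate fixed point on the grid of mesh \<open>1 / p\<close>. Label a grid point in coordinate
  \<open>i\<close> by \<open>0\<close> if \<open>F\<close> does not decrease that coordinate and by \<open>1\<close> otherwise, except that the
  label is always \<open>1\<close> on the face where this coordinate is maximal; Kuhn's lemma provides a grid cell
  that meets both labels in every coordinate.
\<close>

lemma kuhn_near_fixpoint:
  fixes F :: "(nat \<Rightarrow> real) \<Rightarrow> nat \<Rightarrow> real"
  assumes F: "F \<in> unit_cube n \<rightarrow> unit_cube n" and "0 < p"
  shows "\<exists>z\<in>unit_cube n. \<forall>i<n. \<exists>u v. u \<in> unit_cube n \<and> v \<in> unit_cube n \<and>
    (\<forall>j. \<bar>u j - z j\<bar> \<le> 1 / real p) \<and> (\<forall>j. \<bar>v j - z j\<bar> \<le> 1 / real p) \<and>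
    u i \<le> F u i \<and> F v i \<le> v i"
proof -
  define g where "g a = (\<lambda>i. if i < n then real (a i) / real p else 0)" for a :: "nat \<Rightarrow> nat"
  define lab where "lab a i = (if a i = 0 \<or> (a i < p \<and> g a i \<le> F (g a) i) then 0 else 1::nat)"
    for a i
  have g_cube: "g a \<in> unit_cube n" if "\<forall>i<n. a i \<le> p" for a
    using that \<open>0 < p\<close> by (auto simp: unit_cube_def g_def)
  have F_bounds: "0 \<le> F (g a) i" "F (g a) i \<le> 1" if "\<forall>i<n. a i \<le> p" "i < n" for a i
    using funcset_mem[OF F g_cube[OF that(1)]] that(2) by (auto simp: unit_cube_def)
  have lab0: "g a i \<le> F (g a) i" if "\<forall>i<n. a i \<le> p" "i < n" "lab a i = 0" for a i
    using that F_bounds[of a i] by (auto simp: lab_def g_def split: if_splits)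
  have lab1: "F (g a) i \<le> g a i" if "\<forall>i<n. a i \<le> p" "i < n" "lab a i \<noteq> 0" for a i
  proof (cases "a i = p")
    case True
    then show ?thesis
      using F_bounds[of a i] that \<open>0 < p\<close> by (auto simp: g_def)
  next
    case False
    then have "a i < p"
      using that by (simp add: le_neq_implies_less)
    then show ?thesis
      using that by (auto simp: lab_def split: if_splits)
  qed
  have close: "\<bar>g b j - g a j\<bar> \<le> 1 / real p" if "\<forall>j<n. a j \<le> b j \<and> b j \<le> a j + 1" for a b j
  proof (cases "j < n")
    case True
    then have "a j \<le> b j" "b j \<le> a j + 1"
      using that by blast+
    then have "\<bar>real (b j) - real (a j)\<bar> \<le> 1"
      by linarith
    then have "\<bar>real (b j) - real (a j)\<bar> / real p \<le> 1 / real p"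
      by (rule divide_right_mono) simp
    moreover have "g b j - g a j = (real (b j) - real (a j)) / real p"
      using True by (simp add: g_def diff_divide_distrib)
    ultimately show ?thesis
      by (simp add: abs_divide)
  qed (use \<open>0 < p\<close> in \<open>simp add: g_def\<close>)
  obtain q where q: "\<forall>i<n. q i < p"
    and rs: "\<forall>i<n. \<exists>r s. (\<forall>j<n. q j \<le> r j \<and> r j \<le> q j + 1) \<and>
      (\<forall>j<n. q j \<le> s j \<and> s j \<le> q j + 1) \<and> lab r i \<noteq> lab s i"
    by (rule kuhn_lemma[of p n lab]) (use \<open>0 < p\<close> in \<open>auto simp: lab_def\<close>)
  show ?thesis
  proof (intro bexI[of _ "g q"] allI impI)
    show "g q \<in> unit_cube n"
      using q by (intro g_cube) (auto intro: less_imp_le)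
    fix i assume "i < n"
    have "\<exists>r s. (\<forall>j<n. q j \<le> r j \<and> r j \<le> q j + 1) \<and>
      (\<forall>j<n. q j \<le> s j \<and> s j \<le> q j + 1) \<and> lab r i = 0 \<and> lab s i \<noteq> 0"
    proof -
      obtain r s where "\<forall>j<n. q j \<le> r j \<and> r j \<le> q j + 1"
        "\<forall>j<n. q j \<le> s j \<and> s j \<le> q j + 1" "lab r i \<noteq> lab s i"
        using rs \<open>i < n\<close> by blast
      moreover have "lab r i = 0 \<and> lab s i \<noteq> 0 \<or> lab s i = 0 \<and> lab r i \<noteq> 0"
        using \<open>lab r i \<noteq> lab s i\<close> by (auto simp: lab_def split: if_splits)
      ultimately show ?thesis
        by blast
    qed
    then obtain r s where r: "\<forall>j<n. q j \<le> r j \<and> r j \<le> q j + 1" "lab r i = 0"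
      and s: "\<forall>j<n. q j \<le> s j \<and> s j \<le> q j + 1" "lab s i \<noteq> 0"
      by blast
    have r_le: "\<forall>j<n. r j \<le> p" and s_le: "\<forall>j<n. s j \<le> p"
      using q r(1) s(1) by fastforce+
    show "\<exists>u v. u \<in> unit_cube n \<and> v \<in> unit_cube n \<and>
      (\<forall>j. \<bar>u j - g q j\<bar> \<le> 1 / real p) \<and> (\<forall>j. \<bar>v j - g q j\<bar> \<le> 1 / real p) \<and>
      u i \<le> F u i \<and> F v i \<le> v i"
      using g_cube[OF r_le] g_cube[OF s_le] close[OF r(1)] close[OF s(1)]
        lab0[OF r_le \<open>i < n\<close> r(2)] lab1[OF s_le \<open>i < n\<close> s(2)] by blast
  qed
qed

text \<open>
  The approximate fixed points for mesh \<open>1 / (m + 1)\<close> have a convergent subsequence. The grid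
  points \<open>u\<close> and \<open>v\<close> witnessing the two inequalities in a coordinate \<open>i\<close> converge to the same
  limit \<open>x\<close>, which gives \<open>x i \<le> F x i\<close> and \<open>F x i \<le> x i\<close>.
\<close>

lemma brouwer_unit_cube:
  fixes F :: "(nat \<Rightarrow> real) \<Rightarrow> nat \<Rightarrow> real"
  assumes cont: "continuous_on (unit_cube n) F" and F: "F \<in> unit_cube n \<rightarrow> unit_cube n"
  shows "\<exists>x\<in>unit_cube n. F x = x"
proof -
  define Q where "Q m z i u v \<longleftrightarrow> u \<in> unit_cube n \<and> v \<in> unit_cube n \<and>
    (\<forall>j. \<bar>u j - z j\<bar> \<le> 1 / real (Suc m)) \<and> (\<forall>j. \<bar>v j - z j\<bar> \<le> 1 / real (Suc m)) \<and>
    u i \<le> F u i \<and> F v i \<le> v i" for m z i u v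
  have "\<exists>z. z \<in> unit_cube n \<and> (\<forall>i<n. \<exists>u v. Q m z i u v)" for m
    using kuhn_near_fixpoint[OF F zero_less_Suc, of m] unfolding Q_def Bex_def .
  then obtain z where z: "\<And>m. z m \<in> unit_cube n" and "\<And>m. \<forall>i<n. \<exists>u v. Q m (z m) i u v"
    by metis
  then obtain u v where uv: "\<And>m i. i < n \<Longrightarrow> Q m (z m) i (u m i) (v m i)"
    by metis
  obtain x \<phi> where x: "x \<in> unit_cube n" and \<phi>: "strict_mono \<phi>" and lim: "(z \<circ> \<phi>) \<longlonglongrightarrow> x"
    using compact_unit_cube[of n] z unfolding compact_eq_seq_compact_metric seq_compact_def by metis
  have inv_lim: "(\<lambda>m. 1 / real (Suc (\<phi> m))) \<longlonglongrightarrow> 0"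
    using LIMSEQ_subseq_LIMSEQ[OF LIMSEQ_Suc[OF lim_1_over_n] \<phi>] by (simp add: o_def)
  have near: "(\<lambda>m. w (\<phi> m)) \<longlonglongrightarrow> x"
    if "\<And>m j. \<bar>w m j - z m j\<bar> \<le> 1 / real (Suc m)" for w :: "nat \<Rightarrow> nat \<Rightarrow> real"
  proof (rule tendsto_coordinatewise)
    fix j
    have "(\<lambda>m. w (\<phi> m) j - z (\<phi> m) j) \<longlonglongrightarrow> 0"
      by (rule tendsto_rabs_zero_cancel, rule tendsto_sandwich[OF _ _ tendsto_const inv_lim])
        (use that in auto)
    from tendsto_add[OF this tendsto_coordinate[OF lim, of j]]
    show "(\<lambda>m. w (\<phi> m) j) \<longlonglongrightarrow> x j"
      by simp
  qed
  have F_lim: "(\<lambda>m. F (w (\<phi> m)) i) \<longlonglongrightarrow> F x i"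
    if "\<And>m j. \<bar>w m j - z m j\<bar> \<le> 1 / real (Suc m)" "\<And>m. w m \<in> unit_cube n" for w i
  proof -
    have "\<forall>\<^sub>F m in sequentially. w (\<phi> m) \<in> unit_cube n"
      using that(2) by simp
    then have "(\<lambda>m. F (w (\<phi> m))) \<longlonglongrightarrow> F x"
      by (rule continuous_on_tendsto_compose[OF cont near[OF that(1)] x])
    then show ?thesis
      by (rule tendsto_coordinate)
  qed
  have "F x i = x i" for i
  proof (cases "i < n")
    case True
    have u: "\<And>m j. \<bar>u m i j - z m j\<bar> \<le> 1 / real (Suc m)" "\<And>m. u m i \<in> unit_cube n"
        "\<And>m. u m i i \<le> F (u m i) i"
      and v: "\<And>m j. \<bar>v m i j - z m j\<bar> \<le> 1 / real (Suc m)" "\<And>m. v m i \<in> unit_cube n"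
        "\<And>m. F (v m i) i \<le> v m i i"
      using uv[OF True] unfolding Q_def by blast+
    have "x i \<le> F x i"
      using LIMSEQ_le[OF tendsto_coordinate[OF near[OF u(1)]] F_lim[OF u(1,2)]] u(3) by blast
    moreover have "F x i \<le> x i"
      using LIMSEQ_le[OF F_lim[OF v(1,2)] tendsto_coordinate[OF near[OF v(1)]]] v(3) by blast
    ultimately show ?thesis by simp
  next
    case False
    then show ?thesis
      using x F by (auto simp: unit_cube_def Pi_def)
  qed
  with x show ?thesis by blast
qed

section \<open>Covers of the standard simplex\<close>

text \<open>
  The standard simplex with \<open>n\<close> vertices: weight vectors on \<open>{..<n}\<close>, again extended by \<open>0\<close>.
\<close>

definition prob_simplex :: "nat \<Rightarrow> (nat \<Rightarrow> real) set" where
  "prob_simplex n = {x. (\<forall>i<n. 0 \<le> x i) \<and> (\<forall>i\<ge>n. x i = 0) \<and> (\<Sum>i<n. x i) = 1}"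

lemma prob_simplex_subset_unit_cube: "prob_simplex n \<subseteq> unit_cube n"
proof
  fix x assume x: "x \<in> prob_simplex n"
  have "x i \<le> 1" if "i < n" for i
    using x member_le_sum[of i "{..<n}" x] that by (auto simp: prob_simplex_def)
  with x show "x \<in> unit_cube n"
    by (auto simp: prob_simplex_def unit_cube_def)
qed

lemma compact_prob_simplex: "compact (prob_simplex n)"
proof -
  have "closed {x::nat \<Rightarrow> real. (\<Sum>i<n. x i) = 1}"
    by (intro closed_Collect_eq continuous_intros) auto
  moreover have "prob_simplex n = unit_cube n \<inter> {x. (\<Sum>i<n. x i) = 1}"
    using prob_simplex_subset_unit_cube[of n] by (auto simp: prob_simplex_def unit_cube_def)
  ultimately show ?thesis
    using compact_unit_cube by (simp add: compact_Int_closed)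
qed

text \<open>
  A fixed point \<open>x\<close> of \<open>x \<mapsto> (\<beta> i x / (\<Sum>j<n. \<beta> j x))\<^sub>i\<close> has the required property. To
  obtain it from the cube, the map is composed with a retraction of the cube onto the simplex.
\<close>

lemma prob_simplex_point_in_cozero_sets:
  fixes \<beta> :: "nat \<Rightarrow> (nat \<Rightarrow> real) \<Rightarrow> real"
  assumes cont: "\<And>i. i < n \<Longrightarrow> continuous_on (prob_simplex n) (\<beta> i)"
    and nonneg: "\<And>i x. i < n \<Longrightarrow> x \<in> prob_simplex n \<Longrightarrow> 0 \<le> \<beta> i x"
    and pos: "\<And>x. x \<in> prob_simplex n \<Longrightarrow> \<exists>i<n. 0 < \<beta> i x"
    and "0 < n"
  shows "\<exists>x\<in>prob_simplex n. \<forall>i<n. 0 < x i \<longrightarrow> 0 < \<beta> i x"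
proof -
  define s :: "(nat \<Rightarrow> real) \<Rightarrow> real" where "s t = (\<Sum>i<n. t i)" for t
  \<comment> \<open>The retraction: a missing total mass is distributed evenly, an excess is scaled away.\<close>
  define r where "r t = (\<lambda>i. if i < n then (t i + max 0 (1 - s t) / real n) / max 1 (s t) else 0)"
    for t :: "nat \<Rightarrow> real"
  define B where "B x = (\<Sum>i<n. \<beta> i x)" for x
  define F where "F t = (\<lambda>i. if i < n then \<beta> i (r t) / B (r t) else 0)" for t
  have B_pos: "0 < B x" if "x \<in> prob_simplex n" for x
    unfolding B_def using pos[OF that] nonneg that
    by (metis finite_lessThan lessThan_iff sum_pos2)
  have r_simplex: "r t \<in> prob_simplex n" if "t \<in> unit_cube n" for t
  proof -
    have "(\<Sum>i<n. r t i) = (\<Sum>i<n. t i + max 0 (1 - s t) / real n) / max 1 (s t)"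
      by (simp add: r_def sum_divide_distrib)
    also have "\<dots> = (s t + max 0 (1 - s t)) / max 1 (s t)"
      using \<open>0 < n\<close> by (simp add: sum.distrib s_def)
    also have "\<dots> = 1"
      by (simp add: max_def)
    finally show ?thesis
      using that by (auto simp: prob_simplex_def unit_cube_def r_def)
  qed
  have cont_coord: "continuous_on S (\<lambda>t::nat \<Rightarrow> real. t i)" for S i
    by (rule continuous_on_subset[OF continuous_on_product_coordinates]) simp
  have cont_r: "continuous_on (unit_cube n) r"
  proof (rule continuous_on_coordinatewise_then_product)
    fix i
    show "continuous_on (unit_cube n) (\<lambda>t. r t i)"
    proof (cases "i < n")
      case True
      have "max 1 (s t) \<noteq> 0" for t
        by (simp add: max_def)
      then show ?thesis
        using True \<open>0 < n\<close> unfolding r_def s_def by (auto intro!: continuous_intros cont_coord)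
    qed (simp add: r_def)
  qed
  have cont_\<beta>_r: "continuous_on (unit_cube n) (\<lambda>t. \<beta> i (r t))" if "i < n" for i
    by (rule continuous_on_compose2[OF cont[OF that] cont_r]) (use r_simplex in auto)
  have "continuous_on (unit_cube n) F"
  proof (rule continuous_on_coordinatewise_then_product)
    fix i
    have "B (r t) \<noteq> 0" if "t \<in> unit_cube n" for t
      using B_pos[OF r_simplex[OF that]] by simp
    then show "continuous_on (unit_cube n) (\<lambda>t. F t i)"
      unfolding F_def B_def by (cases "i < n") (auto intro!: continuous_intros cont_\<beta>_r)
  qed
  moreover have F_simplex: "F t \<in> prob_simplex n" if "t \<in> unit_cube n" for t
  proof -
    have "(\<Sum>i<n. F t i) = (\<Sum>i<n. \<beta> i (r t)) / B (r t)"
      by (simp add: F_def sum_divide_distrib)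
    then have "(\<Sum>i<n. F t i) = 1"
      using B_pos[OF r_simplex[OF that]] by (simp add: B_def)
    then show ?thesis
      using B_pos[OF r_simplex[OF that]] nonneg[OF _ r_simplex[OF that]]
      by (auto simp: prob_simplex_def F_def)
  qed
  ultimately obtain x where "x \<in> unit_cube n" "F x = x"
    using brouwer_unit_cube[of n F] prob_simplex_subset_unit_cube[of n] by blast
  with F_simplex have x: "x \<in> prob_simplex n"
    by metis
  then have "r x = x"
    by (auto simp: r_def s_def prob_simplex_def)
  have "0 < \<beta> i x" if "i < n" "0 < x i" for i
  proof -
    have "x i = \<beta> i x / B x"
      using \<open>F x = x\<close> \<open>r x = x\<close> that(1) by (metis F_def)
    then show ?thesis
      using that(2) B_pos[OF x] by (simp add: zero_less_divide_iff)
  qed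
  with x show ?thesis
    by blast
qed

lemma prob_simplex_open_cover:
  assumes op: "\<And>i. i < n \<Longrightarrow> openin (top_of_set (prob_simplex n)) (G i)"
    and cover: "prob_simplex n \<subseteq> (\<Union>i<n. G i)" and "0 < n"
  shows "\<exists>x\<in>prob_simplex n. \<forall>i<n. 0 < x i \<longrightarrow> x \<in> G i"
proof -
  let ?D = "prob_simplex n"
  \<comment> \<open>\<open>infdist x {} = 0\<close>, so the case of an empty complement needs its own value.\<close>
  define \<beta> where "\<beta> i x = (if G i = ?D then 1 else infdist x (?D - G i))" for i x
  have pos_iff: "0 < \<beta> i x \<longleftrightarrow> x \<in> G i" if "i < n" "x \<in> ?D" for i x
  proof (cases "G i = ?D")
    case False
    have "closedin (top_of_set ?D) (?D - G i)"
      using op[OF that(1)] by (simp add: closedin_diff)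
    then have "closed (?D - G i)"
      using compact_prob_simplex compact_imp_closed closedin_closed_trans by blast
    moreover have "?D - G i \<noteq> {}"
      using False openin_imp_subset[OF op[OF that(1)]] by blast
    ultimately show ?thesis
      using False that in_closed_iff_infdist_zero[of "?D - G i" x] infdist_nonneg[of x "?D - G i"]
      by (auto simp: \<beta>_def)
  qed (use that in \<open>simp add: \<beta>_def\<close>)
  have "\<exists>x\<in>?D. \<forall>i<n. 0 < x i \<longrightarrow> 0 < \<beta> i x"
  proof (rule prob_simplex_point_in_cozero_sets)
    show "continuous_on ?D (\<beta> i)" for i
      unfolding \<beta>_def by (cases "G i = ?D") (auto intro!: continuous_intros)
    show "\<exists>i<n. 0 < \<beta> i x" if "x \<in> ?D" for x
      using cover that pos_iff by blast
  qed (use \<open>0 < n\<close> in \<open>auto simp: \<beta>_def infdist_nonneg\<close>)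
  then show ?thesis
    using pos_iff by blast
qed

lemma prob_simplex_closed_cover:
  assumes cl: "\<And>i. i < n \<Longrightarrow> closedin (top_of_set (prob_simplex n)) (G i)"
    and cover: "prob_simplex n \<subseteq> (\<Union>i<n. G i)" and "0 < n"
  shows "\<exists>x\<in>prob_simplex n. \<forall>i<n. 0 < x i \<longrightarrow> x \<in> G i"
proof -
  let ?D = "prob_simplex n"
  \<comment> \<open>The open \<open>\<epsilon>\<close>-neighbourhoods of the sets \<open>G i\<close> satisfy the conclusion.\<close>
  have near: "\<exists>x\<in>?D. \<forall>i<n. 0 < x i \<longrightarrow> G i \<noteq> {} \<and> infdist x (G i) < \<epsilon>" if "0 < \<epsilon>" for \<epsilon>
  proof -
    \<comment> \<open>\<open>infdist x {} = 0\<close> would give an empty set positive weight everywhere.\<close>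
    define \<beta> where "\<beta> i x = (if G i = {} then 0 else max 0 (\<epsilon> - infdist x (G i)))" for i x
    have "\<exists>x\<in>?D. \<forall>i<n. 0 < x i \<longrightarrow> 0 < \<beta> i x"
    proof (rule prob_simplex_point_in_cozero_sets)
      show "continuous_on ?D (\<beta> i)" for i
        unfolding \<beta>_def by (cases "G i = {}") (auto intro!: continuous_intros)
      show "\<exists>i<n. 0 < \<beta> i x" if "x \<in> ?D" for x
      proof -
        obtain i where "i < n" "x \<in> G i"
          using cover \<open>x \<in> ?D\<close> by blast
        then have "0 < \<beta> i x"
          using \<open>0 < \<epsilon>\<close> by (auto simp: \<beta>_def)
        with \<open>i < n\<close> show ?thesis by blast
      qed
    qed (use \<open>0 < n\<close> in \<open>auto simp: \<beta>_def\<close>)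
    then show ?thesis
      by (auto simp: \<beta>_def less_max_iff_disj split: if_splits)
  qed
  have "\<exists>x\<in>?D. \<forall>i<n. 0 < x i \<longrightarrow> G i \<noteq> {} \<and> infdist x (G i) < 1 / real (Suc m)" for m
    by (rule near) simp
  then obtain z where z: "\<And>m. z m \<in> ?D"
    and z_near: "\<And>m i. i < n \<Longrightarrow> 0 < z m i \<Longrightarrow> G i \<noteq> {} \<and> infdist (z m) (G i) < 1 / real (Suc m)"
    by metis
  obtain x \<phi> where x: "x \<in> ?D" and \<phi>: "strict_mono \<phi>" and lim: "(z \<circ> \<phi>) \<longlonglongrightarrow> x"
    using compact_prob_simplex[of n] z unfolding compact_eq_seq_compact_metric seq_compact_def by metis
  have inv_lim: "(\<lambda>m. 1 / real (Suc (\<phi> m))) \<longlonglongrightarrow> 0"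
    using LIMSEQ_subseq_LIMSEQ[OF LIMSEQ_Suc[OF lim_1_over_n] \<phi>] by (simp add: o_def)
  have "x \<in> G i" if "i < n" "0 < x i" for i
  proof -
    have "eventually (\<lambda>m. 0 < z (\<phi> m) i) sequentially"
      using order_tendstoD(1)[OF tendsto_coordinate[OF lim, of i] that(2)] by simp
    then have ev: "eventually (\<lambda>m. G i \<noteq> {} \<and> infdist (z (\<phi> m)) (G i) \<le> 1 / real (Suc (\<phi> m))) sequentially"
      by eventually_elim (use z_near that(1) in \<open>auto intro: less_imp_le\<close>)
    then have "G i \<noteq> {}"
      using eventually_happens'[OF sequentially_bot] by blast
    have "infdist x (G i) \<le> 0"
      by (rule tendsto_le[OF _ inv_lim tendsto_infdist[OF lim, of "G i"]])
        (use ev in \<open>auto elim: eventually_mono\<close>)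
    moreover have "closed (G i)"
      using cl[OF that(1)] compact_prob_simplex compact_imp_closed closedin_closed_trans by blast
    ultimately show ?thesis
      using in_closed_iff_infdist_zero[of "G i" x] \<open>G i \<noteq> {}\<close> infdist_nonneg[of x "G i"] by auto
  qed
  with x show ?thesis
    by blast
qed

section \<open>Matching in topological vector spaces\<close>

lemma continuous_on_scaleR_const:
  fixes a :: "'e::topological_real_vector"
  assumes "continuous_on S g"
  shows "continuous_on S (\<lambda>t. g t *\<^sub>R a)"
  unfolding continuous_on_def
proof
  fix t assume "t \<in> S"
  with assms have "(g \<longlongrightarrow> g t) (at t within S)"
    by (simp add: continuous_on_def)
  then have "LIM u at t within S. (g u, a) :> nhds (g t) \<times>\<^sub>F nhds a"
    by (intro filterlim_Pair) auto
  from filterlim_compose[OF tendsto_scaleR_Pair this]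
  show "((\<lambda>u. g u *\<^sub>R a) \<longlongrightarrow> g t *\<^sub>R a) (at t within S)"
    by simp
qed

text \<open>
  Ky Fan's matching theorem, for finite covers by relatively open or by relatively closed sets.
  A space that is not Hausdorff is allowed, and \<open>X\<close> need not be compact.
\<close>

lemma fan_matching:
  fixes X :: "'e::topological_real_vector set" and G :: "'e \<Rightarrow> 'e set"
  assumes "convex X" and M: "finite M" "M \<noteq> {}" "M \<subseteq> X"
    and cover: "X \<subseteq> (\<Union>a\<in>M. G a)"
    and G: "(\<forall>a\<in>M. openin (top_of_set X) (G a)) \<or> (\<forall>a\<in>M. closedin (top_of_set X) (G a))"
  shows "\<exists>u\<in>X. u \<in> convex hull {a\<in>M. u \<in> G a}"
proof -
  define n where "n = card M"
  have "0 < n"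
    using M by (simp add: n_def card_gt_0_iff)
  obtain p where p: "bij_betw p {..<n} M"
    using ex_bij_betw_nat_finite[OF M(1)] by (auto simp: n_def atLeast0LessThan)
  let ?D = "prob_simplex n"
  define \<Phi> where "\<Phi> x = (\<Sum>i<n. x i *\<^sub>R p i)" for x :: "nat \<Rightarrow> real"
  have pM: "p i \<in> M" if "i < n" for i
    using p that by (auto simp: bij_betw_def)
  have \<Phi>_X: "\<Phi> x \<in> X" if "x \<in> ?D" for x
    unfolding \<Phi>_def using that \<open>convex X\<close> pM M(3)
    by (intro convex_sum) (auto simp: prob_simplex_def)
  have cont: "continuous_on ?D \<Phi>"
    unfolding \<Phi>_def
    by (intro continuous_on_sum continuous_on_scaleR_const
        continuous_on_subset[OF continuous_on_product_coordinates]) simp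
  define H where "H i = ?D \<inter> \<Phi> -` G (p i)" for i
  have H_cover: "?D \<subseteq> (\<Union>i<n. H i)"
  proof
    fix x assume "x \<in> ?D"
    then obtain a where "a \<in> M" "\<Phi> x \<in> G a"
      using \<Phi>_X cover by blast
    then show "x \<in> (\<Union>i<n. H i)"
      using p \<open>x \<in> ?D\<close> by (force simp: H_def bij_betw_def)
  qed
  have "\<exists>x\<in>?D. \<forall>i<n. 0 < x i \<longrightarrow> x \<in> H i"
    using G
  proof
    assume "\<forall>a\<in>M. openin (top_of_set X) (G a)"
    then have "openin (top_of_set ?D) (H i)" if "i < n" for i
      unfolding H_def using continuous_openin_preimage[OF cont, of X "G (p i)"] \<Phi>_X pM that by auto
    then show ?thesis
      by (rule prob_simplex_open_cover[OF _ H_cover \<open>0 < n\<close>])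
  next
    assume "\<forall>a\<in>M. closedin (top_of_set X) (G a)"
    then have "closedin (top_of_set ?D) (H i)" if "i < n" for i
      unfolding H_def using continuous_closedin_preimage_gen[OF cont, of X "G (p i)"] \<Phi>_X pM that by auto
    then show ?thesis
      by (rule prob_simplex_closed_cover[OF _ H_cover \<open>0 < n\<close>])
  qed
  then obtain x where x: "x \<in> ?D" and xH: "\<And>i. i < n \<Longrightarrow> 0 < x i \<Longrightarrow> x \<in> H i"
    by blast
  \<comment> \<open>Only vertices of positive weight are known to have \<open>\<Phi> x\<close> in their set.\<close>
  let ?J = "{i. i < n \<and> 0 < x i}"
  have zero: "x i = 0" if "i \<in> {..<n} - ?J" for i
    using x that by (force simp: prob_simplex_def)
  have "(\<Sum>i\<in>?J. x i) = (\<Sum>i<n. x i)"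
    by (rule sum.mono_neutral_left) (use zero in auto)
  also have "\<dots> = 1"
    using x by (simp add: prob_simplex_def)
  finally have "(\<Sum>i\<in>?J. x i *\<^sub>R p i) \<in> convex hull {a\<in>M. \<Phi> x \<in> G a}"
    using pM xH by (intro convex_sum convex_convex_hull hull_inc) (auto simp: H_def)
  moreover have "(\<Sum>i\<in>?J. x i *\<^sub>R p i) = \<Phi> x"
    unfolding \<Phi>_def by (rule sum.mono_neutral_left) (use zero in auto)
  ultimately show ?thesis
    using \<Phi>_X[OF x] by auto
qed

section \<open>Existence of the equilibrium point\<close>

theorem theorem5:
  fixes X :: "'e::topological_real_vector set"
    and C :: "'z::{topological_real_vector, t2_space} set"
    and K :: "'e \<Rightarrow> 'e set"
    and f :: "'e \<times> 'e \<Rightarrow> 'z set"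
    and A :: "'e set"
  assumes X: "X \<noteq> {}" "compact X" "convex X"
    and C: "pointed_cone C" "closed C" "convex C" "interior C \<noteq> {}"
    and K: "correspondence X X K" "\<forall>x\<in>X. K x \<noteq> {}"
    and f: "correspondence (X \<times> X) UNIV f" "\<forall>p\<in>X \<times> X. f p \<noteq> {}"
    and A: "A = {x \<in> X. \<exists>u\<in>K x. f (x, u) \<inter> interior C = {}}"
    and i: "((\<forall>x\<in>X. openin (top_of_set X) (K x)) \<and>
             (\<forall>x\<in>X. openin (top_of_set X) {u \<in> X. f (x, u) \<inter> interior C = {}})) \<or>
            ((\<forall>x\<in>X. closedin (top_of_set X) (K x)) \<and>
             (\<forall>x\<in>X. closedin (top_of_set X) {u \<in> X. f (x, u) \<inter> interior C = {}}))"
    and ii: "\<forall>x\<in>X. f (x, x) \<inter> interior C \<noteq> {}"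
    and iii: "\<exists>M. finite M \<and> M \<noteq> {} \<and> M \<subseteq> X \<and>
      (\<Union>x\<in>M \<inter> A. {u \<in> X. f (x, u) \<inter> interior C = {}} \<inter> K x) \<union> (\<Union>x\<in>M - A. K x) = X"
    and iv: "\<forall>u\<in>X. convex (lower_inverse X K u)"
      "\<forall>u\<in>X. convex ({x \<in> X. f (x, u) \<inter> interior C = {}} \<union> (X - A))"
  shows "\<exists>x\<in>X. x \<in> K x \<and> (\<forall>y\<in>K x. f (x, y) \<inter> interior C \<noteq> {})"
proof -
  define P where "P x = {u \<in> X. f (x, u) \<inter> interior C = {}}" for x
  define G where "G x = (if x \<in> A then P x \<inter> K x else K x)" for x
  obtain M where M: "finite M" "M \<noteq> {}" "M \<subseteq> X"
    and cover: "(\<Union>x\<in>M \<inter> A. P x \<inter> K x) \<union> (\<Union>x\<in>M - A. K x) = X"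
    using iii unfolding P_def by blast
  have "X \<subseteq> (\<Union>x\<in>M. G x)"
    unfolding cover[symmetric] by (auto simp: G_def)
  moreover have "(\<forall>x\<in>M. openin (top_of_set X) (G x)) \<or> (\<forall>x\<in>M. closedin (top_of_set X) (G x))"
    using i M(3) unfolding G_def P_def by (auto intro: openin_Int closedin_Int)
  ultimately obtain u where u: "u \<in> X" "u \<in> convex hull {x\<in>M. u \<in> G x}"
    using fan_matching[OF X(3) M] by blast
  \<comment> \<open>This is the fibre \<open>{x \<in> X. u \<in> G x}\<close>.\<close>
  let ?fib = "lower_inverse X K u \<inter> ({x \<in> X. f (x, u) \<inter> interior C = {}} \<union> (X - A))"
  have "{x\<in>M. u \<in> G x} \<subseteq> ?fib"
    using M(3) by (auto simp: G_def P_def lower_inverse_def split: if_splits)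
  moreover have "convex ?fib"
    using iv u(1) by (intro convex_Int) auto
  ultimately have "u \<in> ?fib"
    using u(2) hull_minimal[of _ ?fib convex] by blast
  then have "u \<in> K u" "u \<notin> A"
    using ii u(1) by (auto simp: lower_inverse_def)
  then show ?thesis
    using u(1) A by blast
qed

end
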